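(* Let $\mathcal{A}=\langle Q_{\mathcal A},\mathbb N\cup\mathbb T,\Delta_{\mathcal A},\mathcal R_{\mathcal A},\varphi_{\mathcal A}\rangle$ and $\mathcal{B}=\langle Q_{\mathcal B},\mathbb N\cup\mathbb T,\Delta_{\mathcal B},\mathcal R_{\mathcal B},\varphi_{\mathcal B}\rangle$ be (symbolic) level-synchronized tree automata such that the terms in leaf symbols and the global constraints $\varphi_{\mathcal A},\varphi_{\mathcal B}$ are expressed in a decidable theory. Then the entailment-checking procedure $\mathsf{Entail}(\mathcal A,\mathcal B)$ described in the context always terminates.
   Context: LSTAs. A (symbolic) level-synchronized tree automaton (LSTA) is a tuple $\mathcal A=\langle Q,\mathbb N\cup\mathbb T,\Delta,\mathcal R,\varphi\rangle$ where $Q$ is a finite set of states, $\mathcal R\subseteq Q$ is the set of root states, $\mathbb T$ is a set of terms built from complex constants and a set $\mathbb X$ of complex variables using function symbols of some fixed theory, and $\Delta$ is a finite set of transitions, each either internal $q\xrightarrow{f,C}(q_1,q_2)$ with $f\in\mathbb N$ or leaf $q\xrightarrow{f,C}()$ with $f\in\mathbb C\cup\mathbb T$, where $q,q_1,q_2\in Q$ and $C\subseteq\mathbb N$ is a finite set of choices. For a transition $\delta$ we write $\mathrm{top}(\delta)=q$, $\mathrm{sym}(\delta)=f$, $\ell(\delta)=C$, $\mathrm{left}(\delta)=q_1$, $\mathrm{right}(\delta)=q_2$, $\mathrm{bot}(\delta)=\{q_1,q_2\}$ (and $\mathrm{bot}(\delta)=\emptyset$ for leaf transitions). Distinct transitions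 with the same top state have disjoint choice sets. The global constraint $\varphi$ is a formula over $\mathbb X$. $\mathrm{vars}(\cdot)$ denotes the free variables of an object. Feasible transition sets. For an LSTA $\mathcal C$ and a finite set of states $D=\{q_1,\dots,q_k\}$, $\mathrm{feas}(\mathcal C,D)$ is the set of all sets $\{\delta_1,\dots,\delta_k\}$ of transitions of $\mathcal C$ with $\mathrm{top}(\delta_i)=q_i$ for all $i$ and $\bigcap_i\ell(\delta_i)\neq\emptyset$. Procedure $\mathsf{FindAllMappings}(\Gamma_{\mathcal A},f)$, where $\Gamma_{\mathcal A}\subseteq\Delta_{\mathcal A}$ and $f$ maps the tops of $\Gamma_{\mathcal A}$ to subsets of $Q_{\mathcal B}$: let $P=\bigcup$ of the image of $f$, and $F'=\emptyset$. For each $\Gamma_{\mathcal B}\in\mathrm{feas}(\mathcal B,P)$: start with empty maps $f'$ (states of $\mathcal A$ to sets of states of $\mathcal B$) and $g'$ (terms to sets of terms); for each $\delta_{\mathcal A}\in\Gamma_{\mathcal A}$ and each $q\in f(\mathrm{top}(\delta_{\mathcal A}))$, let $\delta_{\mathcal B}$ be the unique transition of $\Gamma_{\mathcal B}$ with top $q$; if both are leaf transitions, add $\mathrm{sym}(\delta_{\mathcal B})$ to $g'(\mathrm{sym}(\delta_{\mathcal A}))$; else if both are internal with equal symbol, add $\mathrm{left}(\delta_{\mathcal B})$ to $f'(\mathrm{left}(\delta_{\mathcal A}))$ and $\mathrm{right}(\delta_{\mathcal B})$ to $f'(\mathrm{right}(\delta_{\mathcal A}))$; otherwise mark this $\Gamma_{\mathcal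 B}$ as failed and stop processing it. If not failed, add $(f',g')$ to $F'$. Return $F'$. Procedure $\mathsf{Entail}(\mathcal A,\mathcal B)$, with $\mathcal R_{\mathcal B}=\{r_1,\dots,r_k\}$: set $\mathit{processed}=\emptyset$ and $\mathit{workset}=\{(\{q\},\{(\{q\mapsto\{r_1\}\},\emptyset),\dots,(\{q\mapsto\{r_k\}\},\emptyset)\})\mid q\in\mathcal R_{\mathcal A}\}$. While $\mathit{workset}$ contains some $(D,F)$: remove it and add it to $\mathit{processed}$. If $D=\emptyset$: let $Y$ be the set of variables occurring in the keys $u_1$ of all entries $u_1\mapsto U_2$ of all $g$ with $(\emptyset,g)\in F$, together with $\mathrm{vars}(\varphi_{\mathcal A})$; let $Z$ be the variables occurring in the value sets $U_2$ of those entries together with $\mathrm{vars}(\varphi_{\mathcal B})$, minus $Y$; if the formula $\forall Y\colon\varphi_{\mathcal A}\Rightarrow\exists Z\colon\varphi_{\mathcal B}\wedge\bigvee_{(\emptyset,g)\in F}\exists r\in\mathbb R\setminus\{0\}\colon\bigwedge_{(u_1\mapsto U_2)\in g,\,u_2\in U_2}u_1=r\cdot u_2$ is not valid, return false. Otherwise (for $D\neq\emptyset$), for each $\Gamma_{\mathcal A}\in\mathrm{feas}(\mathcal A,D)$: let $D'=\bigcup_{\delta\in\Gamma_{\mathcal A}}\mathrm{bot}(\delta)$ and $F'=\bigcup_{(f,g)\in F}\{(f',g\uplus g')\mid(f',g')\in\mathsf{FindAllMappings}(\Gamma_{\mathcal A},f)\}$, where $(g\uplus g')(x)=g(x)\cup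 g'(x)$ for $x$ in the union of the domains; if $(D',F')\notin\mathit{processed}\cup\mathit{workset}$, insert it into $\mathit{workset}$. When the workset is empty, return true. The validity check in the $D=\emptyset$ case is performed by a decision procedure for the underlying theory. *)

theory Defs
  imports Complex_Main "HOL-Library.Infinite_Typeclass"
begin

section \<open>First-order theories of the complex numbers\<close>

datatype ('x, 'f) tm = Const complex | Var 'x | App 'f "('x, 'f) tm list"

datatype ('x, 'f, 'p) fm =
    Rel 'p "('x, 'f) tm list"
  | Eq "('x, 'f) tm" "('x, 'f) tm"
  | Tru
  | Fls
  | Neg "('x, 'f, 'p) fm"
  | And "('x, 'f, 'p) fm" "('x, 'f, 'p) fm"
  | Or "('x, 'f, 'p) fm" "('x, 'f, 'p) fm"
  | Imp "('x, 'f, 'p) fm" "('x, 'f, 'p) fm"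
  | All 'x "('x, 'f, 'p) fm"
  | Ex 'x "('x, 'f, 'p) fm"
  | ExReal 'x "('x, 'f, 'p) fm"

text \<open>
  A theory is given by its language and its interpretation over the complex numbers. Its constant
  symbols are those in \<open>constants\<close>; this set need not be all of the complex numbers, since a
  language with uncountably many constants has no effective presentation.
\<close>

record ('f, 'p) fo_theory =
  constants :: "complex set"
  fun_arity :: "'f \<Rightarrow> nat"
  rel_arity :: "'p \<Rightarrow> nat"
  fun_interp :: "'f \<Rightarrow> complex list \<Rightarrow> complex"
  rel_interp :: "'p \<Rightarrow> complex list \<Rightarrow> bool"
  times_symbol :: 'f

text \<open>Zero and multiplication are needed to write the formula
  \<open>\<exists>r \<in> \<real> - {0}. u = r * u'\<close> in the language.\<close>

definition is_fo_theory :: "('f, 'p) fo_theory \<Rightarrow> bool" where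
  "is_fo_theory Th \<longleftrightarrow>
     0 \<in> constants Th \<and>
     fun_arity Th (times_symbol Th) = 2 \<and>
     (\<forall>a b. fun_interp Th (times_symbol Th) [a, b] = a * b)"

fun tm_of_theory :: "('f, 'p) fo_theory \<Rightarrow> ('x, 'f) tm \<Rightarrow> bool" where
  "tm_of_theory Th (Const c) \<longleftrightarrow> c \<in> constants Th"
| "tm_of_theory Th (Var x) \<longleftrightarrow> True"
| "tm_of_theory Th (App h ts) \<longleftrightarrow>
     length ts = fun_arity Th h \<and> (\<forall>t \<in> set ts. tm_of_theory Th t)"

fun fm_of_theory :: "('f, 'p) fo_theory \<Rightarrow> ('x, 'f, 'p) fm \<Rightarrow> bool" where
  "fm_of_theory Th (Rel P ts) \<longleftrightarrow>
     length ts = rel_arity Th P \<and> (\<forall>t \<in> set ts. tm_of_theory Th t)"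
| "fm_of_theory Th (Eq t u) \<longleftrightarrow> tm_of_theory Th t \<and> tm_of_theory Th u"
| "fm_of_theory Th Tru \<longleftrightarrow> True"
| "fm_of_theory Th Fls \<longleftrightarrow> True"
| "fm_of_theory Th (Neg \<phi>) \<longleftrightarrow> fm_of_theory Th \<phi>"
| "fm_of_theory Th (And \<phi> \<psi>) \<longleftrightarrow> fm_of_theory Th \<phi> \<and> fm_of_theory Th \<psi>"
| "fm_of_theory Th (Or \<phi> \<psi>) \<longleftrightarrow> fm_of_theory Th \<phi> \<and> fm_of_theory Th \<psi>"
| "fm_of_theory Th (Imp \<phi> \<psi>) \<longleftrightarrow> fm_of_theory Th \<phi> \<and> fm_of_theory Th \<psi>"
| "fm_of_theory Th (All x \<phi>) \<longleftrightarrow> fm_of_theory Th \<phi>"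
| "fm_of_theory Th (Ex x \<phi>) \<longleftrightarrow> fm_of_theory Th \<phi>"
| "fm_of_theory Th (ExReal x \<phi>) \<longleftrightarrow> fm_of_theory Th \<phi>"

fun tm_vars :: "('x, 'f) tm \<Rightarrow> 'x set" where
  "tm_vars (Const c) = {}"
| "tm_vars (Var x) = {x}"
| "tm_vars (App h ts) = (\<Union>t \<in> set ts. tm_vars t)"

fun fm_vars :: "('x, 'f, 'p) fm \<Rightarrow> 'x set" where
  "fm_vars (Rel P ts) = (\<Union>t \<in> set ts. tm_vars t)"
| "fm_vars (Eq t u) = tm_vars t \<union> tm_vars u"
| "fm_vars Tru = {}"
| "fm_vars Fls = {}"
| "fm_vars (Neg \<phi>) = fm_vars \<phi>"
| "fm_vars (And \<phi> \<psi>) = fm_vars \<phi> \<union> fm_vars \<psi>"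
| "fm_vars (Or \<phi> \<psi>) = fm_vars \<phi> \<union> fm_vars \<psi>"
| "fm_vars (Imp \<phi> \<psi>) = fm_vars \<phi> \<union> fm_vars \<psi>"
| "fm_vars (All x \<phi>) = fm_vars \<phi> - {x}"
| "fm_vars (Ex x \<phi>) = fm_vars \<phi> - {x}"
| "fm_vars (ExReal x \<phi>) = fm_vars \<phi> - {x}"

fun tm_val :: "('f, 'p) fo_theory \<Rightarrow> ('x \<Rightarrow> complex) \<Rightarrow> ('x, 'f) tm \<Rightarrow> complex" where
  "tm_val Th v (Const c) = c"
| "tm_val Th v (Var x) = v x"
| "tm_val Th v (App h ts) = fun_interp Th h (map (tm_val Th v) ts)"

fun sat :: "('f, 'p) fo_theory \<Rightarrow> ('x \<Rightarrow> complex) \<Rightarrow> ('x, 'f, 'p) fm \<Rightarrow> bool" where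
  "sat Th v (Rel P ts) \<longleftrightarrow> rel_interp Th P (map (tm_val Th v) ts)"
| "sat Th v (Eq t u) \<longleftrightarrow> tm_val Th v t = tm_val Th v u"
| "sat Th v Tru \<longleftrightarrow> True"
| "sat Th v Fls \<longleftrightarrow> False"
| "sat Th v (Neg \<phi>) \<longleftrightarrow> \<not> sat Th v \<phi>"
| "sat Th v (And \<phi> \<psi>) \<longleftrightarrow> sat Th v \<phi> \<and> sat Th v \<psi>"
| "sat Th v (Or \<phi> \<psi>) \<longleftrightarrow> sat Th v \<phi> \<or> sat Th v \<psi>"
| "sat Th v (Imp \<phi> \<psi>) \<longleftrightarrow> (sat Th v \<phi> \<longrightarrow> sat Th v \<psi>)"
| "sat Th v (All x \<phi>) \<longleftrightarrow> (\<forall>a. sat Th (v(x := a)) \<phi>)"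
| "sat Th v (Ex x \<phi>) \<longleftrightarrow> (\<exists>a. sat Th (v(x := a)) \<phi>)"
| "sat Th v (ExReal x \<phi>) \<longleftrightarrow> (\<exists>a \<in> \<real>. sat Th (v(x := a)) \<phi>)"

definition valid :: "('f, 'p) fo_theory \<Rightarrow> ('x, 'f, 'p) fm \<Rightarrow> bool" where
  "valid Th \<phi> \<longleftrightarrow> (\<forall>v. sat Th v \<phi>)"

definition sentence_of_theory :: "('f, 'p) fo_theory \<Rightarrow> ('x, 'f, 'p) fm \<Rightarrow> bool" where
  "sentence_of_theory Th \<phi> \<longleftrightarrow> fm_of_theory Th \<phi> \<and> fm_vars \<phi> = {}"


section \<open>Decision procedures\<close>

text \<open>
  A machine with configurations \<open>'c\<close>: \<open>tick\<close> either continues with a new configuration or stops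
  with an answer. Any concrete model of computation is an instance; nothing forces a machine to
  stop.
\<close>

record ('i, 'c) machine =
  start :: "'i \<Rightarrow> 'c"
  tick :: "'c \<Rightarrow> 'c + bool"

inductive answers :: "('i, 'c) machine \<Rightarrow> 'c \<Rightarrow> bool \<Rightarrow> bool" for M where
  "tick M c = Inr b \<Longrightarrow> answers M c b"
| "tick M c = Inl c' \<Longrightarrow> answers M c' b \<Longrightarrow> answers M c b"

definition decision_procedure ::
    "(('x, 'f, 'p) fm, 'c) machine \<Rightarrow> ('f, 'p) fo_theory \<Rightarrow> bool" where
  "decision_procedure M Th \<longleftrightarrow>
     (\<forall>\<phi>. sentence_of_theory Th \<phi> \<longrightarrow> answers M (start M \<phi>) (valid Th \<phi>))"


section \<open>Level-synchronized tree automata\<close>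

datatype ('q, 'x, 'f) transition =
    Internal (top_state: 'q) (int_symbol: nat) (choices: "nat set") (left: 'q) (right: 'q)
  | Leaf (top_state: 'q) (leaf_symbol: "('x, 'f) tm") (choices: "nat set")

fun bot_states :: "('q, 'x, 'f) transition \<Rightarrow> 'q set" where
  "bot_states (Internal q n C l r) = {l, r}"
| "bot_states (Leaf q u C) = {}"

record ('q, 'x, 'f, 'p) lsta =
  states :: "'q set"
  transitions :: "('q, 'x, 'f) transition set"
  root_states :: "'q set"
  constraint :: "('x, 'f, 'p) fm"

definition is_lsta :: "('q, 'x, 'f, 'p) lsta \<Rightarrow> bool" where
  "is_lsta \<A> \<longleftrightarrow>
     finite (states \<A>) \<and> root_states \<A> \<subseteq> states \<A> \<and> finite (transitions \<A>) \<and>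
     (\<forall>\<delta> \<in> transitions \<A>.
        top_state \<delta> \<in> states \<A> \<and> bot_states \<delta> \<subseteq> states \<A> \<and> finite (choices \<delta>)) \<and>
     (\<forall>\<delta> \<in> transitions \<A>. \<forall>\<delta>' \<in> transitions \<A>.
        \<delta> \<noteq> \<delta>' \<longrightarrow> top_state \<delta> = top_state \<delta>' \<longrightarrow> choices \<delta> \<inter> choices \<delta>' = {})"

definition expressed_in :: "('q, 'x, 'f, 'p) lsta \<Rightarrow> ('f, 'p) fo_theory \<Rightarrow> bool" where
  "expressed_in \<A> Th \<longleftrightarrow>
     (\<forall>q u C. Leaf q u C \<in> transitions \<A> \<longrightarrow> tm_of_theory Th u) \<and>
     fm_of_theory Th (constraint \<A>)"

definition feas :: "('q, 'x, 'f, 'p) lsta \<Rightarrow> 'q set \<Rightarrow> ('q, 'x, 'f) transition set set" where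
  "feas \<C> D =
     {d ` D | d. (\<forall>q \<in> D. d q \<in> transitions \<C> \<and> top_state (d q) = q) \<and>
                 (\<Inter>q \<in> D. choices (d q)) \<noteq> {}}"


section \<open>The validity check\<close>

type_synonym ('x, 'f) term_map = "('x, 'f) tm \<rightharpoonup> ('x, 'f) tm set"
type_synonym ('a, 'b) state_map = "'a \<rightharpoonup> 'b set"

text \<open>The order in which a finite set is turned into a quantifier block, a conjunction or a
  disjunction is irrelevant, hence left unspecified.\<close>

definition enum :: "'a set \<Rightarrow> 'a list" where
  "enum S = (SOME xs. set xs = S \<and> distinct xs)"

definition All_set :: "'x set \<Rightarrow> ('x, 'f, 'p) fm \<Rightarrow> ('x, 'f, 'p) fm" where
  "All_set X \<phi> = foldr All (enum X) \<phi>"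

definition Ex_set :: "'x set \<Rightarrow> ('x, 'f, 'p) fm \<Rightarrow> ('x, 'f, 'p) fm" where
  "Ex_set X \<phi> = foldr Ex (enum X) \<phi>"

definition And_set :: "('x, 'f, 'p) fm set \<Rightarrow> ('x, 'f, 'p) fm" where
  "And_set \<Phi> = foldr And (enum \<Phi>) Tru"

definition Or_set :: "('x, 'f, 'p) fm set \<Rightarrow> ('x, 'f, 'p) fm" where
  "Or_set \<Phi> = foldr Or (enum \<Phi>) Fls"

definition key_vars :: "('x, 'f) term_map set \<Rightarrow> 'x set" where
  "key_vars G = (\<Union>g \<in> G. \<Union>u \<in> dom g. tm_vars u)"

definition value_vars :: "('x, 'f) term_map set \<Rightarrow> 'x set" where
  "value_vars G = (\<Union>g \<in> G. \<Union>U \<in> ran g. \<Union>u \<in> U. tm_vars u)"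

definition ratio_fm :: "('f, 'p) fo_theory \<Rightarrow> 'x \<Rightarrow> ('x, 'f) term_map \<Rightarrow> ('x, 'f, 'p) fm" where
  "ratio_fm Th r g =
     ExReal r
       (And (Neg (Eq (Var r) (Const 0)))
            (And_set {Eq u\<^sub>1 (App (times_symbol Th) [Var r, u\<^sub>2]) | u\<^sub>1 U\<^sub>2 u\<^sub>2.
                        g u\<^sub>1 = Some U\<^sub>2 \<and> u\<^sub>2 \<in> U\<^sub>2}))"

definition check_fm ::
    "('f, 'p) fo_theory \<Rightarrow> ('x, 'f, 'p) fm \<Rightarrow> ('x, 'f, 'p) fm \<Rightarrow> ('x, 'f) term_map set
       \<Rightarrow> ('x, 'f, 'p) fm" where
  "check_fm Th \<phi>\<^sub>A \<phi>\<^sub>B G =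
     (let Y = key_vars G \<union> fm_vars \<phi>\<^sub>A;
          Z = (value_vars G \<union> fm_vars \<phi>\<^sub>B) - Y;
          r = (SOME r. r \<notin> Y \<union> Z)
      in All_set Y (Imp \<phi>\<^sub>A (Ex_set Z (And \<phi>\<^sub>B (Or_set (ratio_fm Th r ` G))))))"


section \<open>The procedure FindAllMappings\<close>

definition entry :: "('k \<rightharpoonup> 'v set) \<Rightarrow> 'k \<Rightarrow> 'v set" where
  "entry m k = (case m k of None \<Rightarrow> {} | Some S \<Rightarrow> S)"

definition add_to :: "('k \<rightharpoonup> 'v set) \<Rightarrow> 'k \<Rightarrow> 'v \<Rightarrow> ('k \<rightharpoonup> 'v set)" where
  "add_to m k v = m(k \<mapsto> insert v (entry m k))"

definition merge :: "('k \<rightharpoonup> 'v set) \<Rightarrow> ('k \<rightharpoonup> 'v set) \<Rightarrow> ('k \<rightharpoonup> 'v set)" where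
  "merge g g' = (\<lambda>k. if k \<in> dom g \<union> dom g' then Some (entry g k \<union> entry g' k) else None)"

text \<open>\<open>None\<close> signals failure.\<close>

fun match_transitions ::
    "('a, 'x, 'f) transition \<Rightarrow> ('b, 'x, 'f) transition \<Rightarrow>
     ('a, 'b) state_map \<times> ('x, 'f) term_map \<Rightarrow>
     (('a, 'b) state_map \<times> ('x, 'f) term_map) option" where
  "match_transitions (Leaf _ u\<^sub>A _) (Leaf _ u\<^sub>B _) (f, g) = Some (f, add_to g u\<^sub>A u\<^sub>B)"
| "match_transitions (Internal _ n\<^sub>A _ l\<^sub>A r\<^sub>A) (Internal _ n\<^sub>B _ l\<^sub>B r\<^sub>B) (f, g) =
     (if n\<^sub>A = n\<^sub>B then Some (add_to (add_to f l\<^sub>A l\<^sub>B) r\<^sub>A r\<^sub>B, g) else None)"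
| "match_transitions _ _ _ = None"

text \<open>
  Small-step semantics. The last argument of \<open>Fam_Loop\<close> is the result accumulated so far, and
  the other set arguments \<open>S\<close>, \<open>T\<close> are what is still to be visited by the surrounding for-loops;
  the order of the visits is arbitrary. \<open>Fam_Loop {} F'\<close> is the final configuration with result
  \<open>F'\<close>.
\<close>

datatype ('a, 'b, 'x, 'f) fam_conf =
    Fam_Loop
      "('b, 'x, 'f) transition set set"
      "(('a, 'b) state_map \<times> ('x, 'f) term_map) set"
  | Fam_Body
      "('b, 'x, 'f) transition set set"
      "(('a, 'b) state_map \<times> ('x, 'f) term_map) set"
      "('b, 'x, 'f) transition set"
      "(('a, 'x, 'f) transition \<times> 'b) set"
      "('a, 'b) state_map \<times> ('x, 'f) term_map"

definition fam_init ::
    "('b, 'x, 'f, 'p) lsta \<Rightarrow> ('a, 'b) state_map \<Rightarrow> ('a, 'b, 'x, 'f) fam_conf" where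
  "fam_init \<B> f = Fam_Loop (feas \<B> (\<Union> (ran f))) {}"

inductive fam_step ::
    "('a, 'x, 'f) transition set \<Rightarrow> ('a, 'b) state_map \<Rightarrow>
     ('a, 'b, 'x, 'f) fam_conf \<Rightarrow> ('a, 'b, 'x, 'f) fam_conf \<Rightarrow> bool"
  for \<Gamma>\<^sub>A f where
  fam_pick:
    "\<Gamma>\<^sub>B \<in> S \<Longrightarrow>
     fam_step \<Gamma>\<^sub>A f (Fam_Loop S F')
       (Fam_Body (S - {\<Gamma>\<^sub>B}) F' \<Gamma>\<^sub>B {(\<delta>\<^sub>A, q). \<delta>\<^sub>A \<in> \<Gamma>\<^sub>A \<and> q \<in> entry f (top_state \<delta>\<^sub>A)}
          (Map.empty, Map.empty))"
| fam_match:
    "(\<delta>\<^sub>A, q) \<in> T \<Longrightarrow> \<delta>\<^sub>B = (THE \<delta>. \<delta> \<in> \<Gamma>\<^sub>B \<and> top_state \<delta> = q) \<Longrightarrow>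
     match_transitions \<delta>\<^sub>A \<delta>\<^sub>B m = Some m' \<Longrightarrow>
     fam_step \<Gamma>\<^sub>A f (Fam_Body S F' \<Gamma>\<^sub>B T m) (Fam_Body S F' \<Gamma>\<^sub>B (T - {(\<delta>\<^sub>A, q)}) m')"
| fam_fail:
    "(\<delta>\<^sub>A, q) \<in> T \<Longrightarrow> \<delta>\<^sub>B = (THE \<delta>. \<delta> \<in> \<Gamma>\<^sub>B \<and> top_state \<delta> = q) \<Longrightarrow>
     match_transitions \<delta>\<^sub>A \<delta>\<^sub>B m = None \<Longrightarrow>
     fam_step \<Gamma>\<^sub>A f (Fam_Body S F' \<Gamma>\<^sub>B T m) (Fam_Loop S F')"
| fam_add:
    "fam_step \<Gamma>\<^sub>A f (Fam_Body S F' \<Gamma>\<^sub>B {} m) (Fam_Loop S (insert m F'))"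


section \<open>The procedure Entail\<close>

type_synonym ('a, 'b, 'x, 'f) item =
  "'a set \<times> (('a, 'b) state_map \<times> ('x, 'f) term_map) set"

text \<open>
  Every configuration that has not returned starts with \<open>processed\<close> and \<open>workset\<close>:
  \<open>While\<close> is the head of the main loop, \<open>Check\<close> is inside a run of the decision procedure,
  \<open>For_Trans\<close> and \<open>For_Map\<close> are the heads of the loops over the feasible sets of transitions and
  over the pairs in \<open>F\<close>, and \<open>Call\<close> is inside a call of FindAllMappings.
\<close>

datatype ('a, 'b, 'x, 'f, 'c) conf =
    While "('a, 'b, 'x, 'f) item set" "('a, 'b, 'x, 'f) item set"
  | Check "('a, 'b, 'x, 'f) item set" "('a, 'b, 'x, 'f) item set" 'c
  | For_Trans "('a, 'b, 'x, 'f) item set" "('a, 'b, 'x, 'f) item set"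
      "(('a, 'b) state_map \<times> ('x, 'f) term_map) set"
      "('a, 'x, 'f) transition set set"
  | For_Map "('a, 'b, 'x, 'f) item set" "('a, 'b, 'x, 'f) item set"
      "(('a, 'b) state_map \<times> ('x, 'f) term_map) set"
      "('a, 'x, 'f) transition set set"
      "('a, 'x, 'f) transition set"
      "(('a, 'b) state_map \<times> ('x, 'f) term_map) set"
      "(('a, 'b) state_map \<times> ('x, 'f) term_map) set"
  | Call "('a, 'b, 'x, 'f) item set" "('a, 'b, 'x, 'f) item set"
      "(('a, 'b) state_map \<times> ('x, 'f) term_map) set"
      "('a, 'x, 'f) transition set set"
      "('a, 'x, 'f) transition set"
      "(('a, 'b) state_map \<times> ('x, 'f) term_map) set"
      "(('a, 'b) state_map \<times> ('x, 'f) term_map) set"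
      "('a, 'b) state_map" "('x, 'f) term_map"
      "('a, 'b, 'x, 'f) fam_conf"
  | Return bool

definition entail_init ::
    "('a, 'x, 'f, 'p) lsta \<Rightarrow> ('b, 'x, 'f, 'p) lsta \<Rightarrow> ('a, 'b, 'x, 'f, 'c) conf" where
  "entail_init \<A> \<B> =
     While {}
       {({q}, {([q \<mapsto> {r}], Map.empty) | r. r \<in> root_states \<B>}) | q. q \<in> root_states \<A>}"

inductive entail_step ::
    "('f, 'p) fo_theory \<Rightarrow> (('x, 'f, 'p) fm, 'c) machine \<Rightarrow>
     ('a, 'x, 'f, 'p) lsta \<Rightarrow> ('b, 'x, 'f, 'p) lsta \<Rightarrow>
     ('a, 'b, 'x, 'f, 'c) conf \<Rightarrow> ('a, 'b, 'x, 'f, 'c) conf \<Rightarrow> bool"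
  for Th M \<A> \<B> where
  while_end:
    "entail_step Th M \<A> \<B> (While P {}) (Return True)"
| while_check:
    "({}, F) \<in> W \<Longrightarrow>
     entail_step Th M \<A> \<B> (While P W)
       (Check (insert ({}, F) P) (W - {({}, F)})
          (start M (check_fm Th (constraint \<A>) (constraint \<B>) {g. (Map.empty, g) \<in> F})))"
| while_expand:
    "(D, F) \<in> W \<Longrightarrow> D \<noteq> {} \<Longrightarrow>
     entail_step Th M \<A> \<B> (While P W)
       (For_Trans (insert (D, F) P) (W - {(D, F)}) F (feas \<A> D))"
| check_tick:
    "tick M c = Inl c' \<Longrightarrow> entail_step Th M \<A> \<B> (Check P W c) (Check P W c')"
| check_valid:
    "tick M c = Inr True \<Longrightarrow> entail_step Th M \<A> \<B> (Check P W c) (While P W)"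
| check_invalid:
    "tick M c = Inr False \<Longrightarrow> entail_step Th M \<A> \<B> (Check P W c) (Return False)"
| trans_pick:
    "\<Gamma>\<^sub>A \<in> S \<Longrightarrow>
     entail_step Th M \<A> \<B> (For_Trans P W F S) (For_Map P W F (S - {\<Gamma>\<^sub>A}) \<Gamma>\<^sub>A F {})"
| trans_end:
    "entail_step Th M \<A> \<B> (For_Trans P W F {}) (While P W)"
| map_call:
    "(f, g) \<in> T \<Longrightarrow>
     entail_step Th M \<A> \<B> (For_Map P W F S \<Gamma>\<^sub>A T F')
       (Call P W F S \<Gamma>\<^sub>A (T - {(f, g)}) F' f g (fam_init \<B> f))"
| map_end:
    "W' = (if (\<Union> (bot_states ` \<Gamma>\<^sub>A), F') \<in> P \<union> W then W
           else insert (\<Union> (bot_states ` \<Gamma>\<^sub>A), F') W) \<Longrightarrow>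
     entail_step Th M \<A> \<B> (For_Map P W F S \<Gamma>\<^sub>A {} F') (For_Trans P W' F S)"
| call_step:
    "fam_step \<Gamma>\<^sub>A f m m' \<Longrightarrow>
     entail_step Th M \<A> \<B> (Call P W F S \<Gamma>\<^sub>A T F' f g m) (Call P W F S \<Gamma>\<^sub>A T F' f g m')"
| call_return:
    "entail_step Th M \<A> \<B> (Call P W F S \<Gamma>\<^sub>A T F' f g (Fam_Loop {} R))
       (For_Map P W F S \<Gamma>\<^sub>A T (F' \<union> {(f', merge g g') | f' g'. (f', g') \<in> R}))"

text \<open>All runs are finite, and they stop only in a final configuration.\<close>

definition always_terminates :: "('s \<Rightarrow> 's \<Rightarrow> bool) \<Rightarrow> 's \<Rightarrow> 's set \<Rightarrow> bool" where
  "always_terminates step s\<^sub>0 Final \<longleftrightarrow>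
     (\<nexists>\<rho> :: nat \<Rightarrow> 's. \<rho> 0 = s\<^sub>0 \<and> (\<forall>i. step (\<rho> i) (\<rho> (Suc i)))) \<and>
     (\<forall>s. step\<^sup>*\<^sup>* s\<^sub>0 s \<longrightarrow> (\<nexists>s'. step s s') \<longrightarrow> s \<in> Final)"

end

theory Submission
  imports Defs
begin

text \<open>
  Every item ever produced pairs a set of states of \<open>\<A>\<close> with a set of pairs of partial maps whose
  keys and values are states and leaf terms of the two automata, so items range over a finite
  universe. Each round of the main loop moves an item of the universe from \<open>workset\<close> to \<open>processed\<close>
  for good, the inner loops run over finite sets, and the decision procedure halts because all
  formulas handed to it are sentences of the theory.
\<close>

section \<open>Halting\<close>

text \<open>The well-founded part of the reversed step relation, strengthened so that a
  configuration without successor must be final. Being inductive, it asks for no numeric bound on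
  the length of runs, which the decision procedure could not supply.\<close>

inductive halts :: "('s \<Rightarrow> 's \<Rightarrow> bool) \<Rightarrow> 's set \<Rightarrow> 's \<Rightarrow> bool" for step Final where
  haltsI: "s \<in> Final \<or> (\<exists>s'. step s s') \<Longrightarrow> (\<And>s'. step s s' \<Longrightarrow> halts step Final s') \<Longrightarrow>
    halts step Final s"

text \<open>The position \<open>k\<close> is kept arbitrary so that the induction hypothesis for the
  successor \<open>\<rho> (Suc k)\<close> applies to the same run, read from one position
  later.\<close>

lemma halts_no_infinite_run:
  assumes "halts step Final s"
  shows "\<rho> k = s \<Longrightarrow> \<exists>i. \<not> step (\<rho> i) (\<rho> (Suc i))"
  using assms
proof (induction arbitrary: k rule: halts.induct)
  case (haltsI s)
  then show ?case
    by metis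
qed

lemma halts_reachable:
  assumes "step\<^sup>*\<^sup>* s s'" and "halts step Final s"
  shows "halts step Final s'"
  using assms by (induction rule: rtranclp_induct) (auto elim: halts.cases)

lemma halts_always_terminates:
  fixes s :: 's
  assumes "halts step Final s"
  shows "always_terminates step s Final"
  unfolding always_terminates_def
proof (intro conjI allI impI notI)
  assume "\<exists>\<rho>::nat \<Rightarrow> 's. \<rho> 0 = s \<and> (\<forall>i. step (\<rho> i) (\<rho> (Suc i)))"
  then show False
    using halts_no_infinite_run[OF assms] by blast
next
  fix s' assume reach: "step\<^sup>*\<^sup>* s s'" and "\<nexists>s''. step s' s''"
  then show "s' \<in> Final"
    using halts_reachable[OF reach assms] by (blast elim: halts.cases)
qed


section \<open>Quantifier blocks, conjunctions and disjunctions\<close>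

lemma finite_tm_vars: "finite (tm_vars t)"
  by (induction t) auto

lemma finite_fm_vars: "finite (fm_vars \<phi>)"
  by (induction \<phi>) (auto simp: finite_tm_vars)

text \<open>\<open>SOME\<close> yields a list of the elements of \<open>S\<close> only if such a
  list exists; the finiteness side conditions of the lemmas below come from here.\<close>

lemma set_enum: "finite S \<Longrightarrow> set (enum S) = S"
  unfolding enum_def using someI_ex[OF finite_distinct_list[of S]] by blast

lemma fm_of_theory_All_set [simp]: "fm_of_theory Th (All_set X \<phi>) = fm_of_theory Th \<phi>"
proof -
  have "fm_of_theory Th (foldr All xs \<phi>) = fm_of_theory Th \<phi>" for xs
    by (induction xs) auto
  then show ?thesis
    by (simp add: All_set_def)
qed

lemma fm_of_theory_Ex_set [simp]: "fm_of_theory Th (Ex_set X \<phi>) = fm_of_theory Th \<phi>"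
proof -
  have "fm_of_theory Th (foldr Ex xs \<phi>) = fm_of_theory Th \<phi>" for xs
    by (induction xs) auto
  then show ?thesis
    by (simp add: Ex_set_def)
qed

lemma fm_vars_All_set:
  assumes "finite X"
  shows "fm_vars (All_set X \<phi>) = fm_vars \<phi> - X"
proof -
  have "fm_vars (foldr All xs \<phi>) = fm_vars \<phi> - set xs" for xs
    by (induction xs) auto
  then show ?thesis
    by (simp add: All_set_def set_enum[OF assms])
qed

lemma fm_vars_Ex_set:
  assumes "finite X"
  shows "fm_vars (Ex_set X \<phi>) = fm_vars \<phi> - X"
proof -
  have "fm_vars (foldr Ex xs \<phi>) = fm_vars \<phi> - set xs" for xs
    by (induction xs) auto
  then show ?thesis
    by (simp add: Ex_set_def set_enum[OF assms])
qed

lemma fm_of_theory_And_set: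
  fixes \<Phi> :: "('x, 'f, 'p) fm set"
  assumes "finite \<Phi>"
  shows "fm_of_theory Th (And_set \<Phi>) \<longleftrightarrow> (\<forall>\<phi> \<in> \<Phi>. fm_of_theory Th \<phi>)"
proof -
  have "fm_of_theory Th (foldr And xs Tru) \<longleftrightarrow> (\<forall>\<phi> \<in> set xs. fm_of_theory Th \<phi>)"
    for xs :: "('x, 'f, 'p) fm list"
    by (induction xs) auto
  then show ?thesis
    by (simp add: And_set_def set_enum[OF assms])
qed

lemma fm_of_theory_Or_set:
  fixes \<Phi> :: "('x, 'f, 'p) fm set"
  assumes "finite \<Phi>"
  shows "fm_of_theory Th (Or_set \<Phi>) \<longleftrightarrow> (\<forall>\<phi> \<in> \<Phi>. fm_of_theory Th \<phi>)"
proof -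
  have "fm_of_theory Th (foldr Or xs Fls) \<longleftrightarrow> (\<forall>\<phi> \<in> set xs. fm_of_theory Th \<phi>)"
    for xs :: "('x, 'f, 'p) fm list"
    by (induction xs) auto
  then show ?thesis
    by (simp add: Or_set_def set_enum[OF assms])
qed

lemma fm_vars_And_set:
  fixes \<Phi> :: "('x, 'f, 'p) fm set"
  assumes "finite \<Phi>"
  shows "fm_vars (And_set \<Phi>) = (\<Union>\<phi> \<in> \<Phi>. fm_vars \<phi>)"
proof -
  have "fm_vars (foldr And xs Tru) = (\<Union>\<phi> \<in> set xs. fm_vars \<phi>)"
    for xs :: "('x, 'f, 'p) fm list"
    by (induction xs) auto
  then show ?thesis
    by (simp add: And_set_def set_enum[OF assms])
qed

lemma fm_vars_Or_set:
  fixes \<Phi> :: "('x, 'f, 'p) fm set"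
  assumes "finite \<Phi>"
  shows "fm_vars (Or_set \<Phi>) = (\<Union>\<phi> \<in> \<Phi>. fm_vars \<phi>)"
proof -
  have "fm_vars (foldr Or xs Fls) = (\<Union>\<phi> \<in> set xs. fm_vars \<phi>)"
    for xs :: "('x, 'f, 'p) fm list"
    by (induction xs) auto
  then show ?thesis
    by (simp add: Or_set_def set_enum[OF assms])
qed


section \<open>Maps with bounded keys and values\<close>

text \<open>A common bound for state maps (\<open>K\<close>, \<open>V\<close> sets of states) and
  term maps (\<open>K\<close>, \<open>V\<close> sets of leaf terms). Domains may be smaller than
  \<open>K\<close> because the loops add keys one by one.\<close>

definition maps_over :: "'k set \<Rightarrow> 'v set \<Rightarrow> ('k \<rightharpoonup> 'v set) set" where
  "maps_over K V = {m. dom m \<subseteq> K \<and> ran m \<subseteq> Pow V}"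

lemma finite_maps_over:
  assumes "finite K" and "finite V"
  shows "finite (maps_over K V)"
proof -
  \<comment> \<open>Maps with one exact domain are known to be finite in number, so the set is split
    by domain.\<close>
  have "maps_over K V = (\<Union>D \<in> Pow K. {m. dom m = D \<and> ran m \<subseteq> Pow V})"
    by (auto simp: maps_over_def)
  moreover have "finite {m. dom m = D \<and> ran m \<subseteq> Pow V}" if "D \<in> Pow K" for D
    using that assms by (intro finite_set_of_finite_maps) (auto intro: finite_subset)
  ultimately show ?thesis
    using assms by simp
qed

lemma empty_in_maps_over: "Map.empty \<in> maps_over K V"
  by (simp add: maps_over_def)

lemma entry_subset: "m \<in> maps_over K V \<Longrightarrow> entry m k \<subseteq> V"
  by (force simp: maps_over_def entry_def ran_def split: option.splits)

lemma add_to_in_maps_over: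
  assumes "m \<in> maps_over K V" "k \<in> K" "v \<in> V"
  shows "add_to m k v \<in> maps_over K V"
  using assms entry_subset[OF assms(1), of k]
  by (auto simp: maps_over_def add_to_def ran_def)

lemma merge_in_maps_over:
  assumes "m \<in> maps_over K V" "m' \<in> maps_over K V"
  shows "merge m m' \<in> maps_over K V"
proof -
  have "dom (merge m m') = dom m \<union> dom m'"
    by (auto simp: merge_def split: if_splits)
  moreover have "W \<subseteq> V" if "merge m m' k = Some W" for k W
    using that assms[THEN entry_subset] by (auto simp: merge_def split: if_splits)
  ultimately show ?thesis
    using assms by (auto simp: maps_over_def ran_def)
qed


section \<open>The validity check is a sentence of the theory\<close>

text \<open>Each equation is determined by a pair in \<open>K \<times> V\<close>. The function
  \<open>h\<close> stands for multiplication by the variable \<open>r\<close>, as in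
  \<open>ratio_fm\<close>.\<close>

lemma finite_equations:
  assumes "g \<in> maps_over K V" "finite K" "finite V"
  shows "finite {Eq u\<^sub>1 (h u\<^sub>2) | u\<^sub>1 U\<^sub>2 u\<^sub>2. g u\<^sub>1 = Some U\<^sub>2 \<and> u\<^sub>2 \<in> U\<^sub>2}"
proof (rule finite_subset)
  show "{Eq u\<^sub>1 (h u\<^sub>2) | u\<^sub>1 U\<^sub>2 u\<^sub>2. g u\<^sub>1 = Some U\<^sub>2 \<and> u\<^sub>2 \<in> U\<^sub>2} \<subseteq>
      (\<lambda>(u\<^sub>1, u\<^sub>2). Eq u\<^sub>1 (h u\<^sub>2)) ` (K \<times> V)"
    using assms(1) by (fastforce simp: maps_over_def ran_def image_iff)
qed (use assms in simp)

text \<open>Besides the terms in \<open>g\<close>, the formula contains only \<open>0\<close> and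
  the binary multiplication symbol, both supplied by \<open>is_fo_theory\<close>.\<close>

lemma fm_of_theory_ratio_fm:
  assumes "is_fo_theory Th" "g \<in> maps_over K V" "finite K" "finite V"
    and "\<And>u. u \<in> K \<union> V \<Longrightarrow> tm_of_theory Th u"
  shows "fm_of_theory Th (ratio_fm Th r g)"
proof -
  have "tm_of_theory Th u\<^sub>1 \<and> tm_of_theory Th u\<^sub>2" if "g u\<^sub>1 = Some U\<^sub>2" "u\<^sub>2 \<in> U\<^sub>2" for u\<^sub>1 U\<^sub>2 u\<^sub>2
  proof -
    have "u\<^sub>1 \<in> K" "u\<^sub>2 \<in> V"
      using assms(2) that by (auto simp: maps_over_def ran_def)
    then show ?thesis
      using assms(5) by blast
  qed
  then show ?thesis
    using assms(1)
    by (auto simp: ratio_fm_def is_fo_theory_def fm_of_theory_And_set[OF finite_equations[OF assms(2-4)]])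
qed

text \<open>\<open>ExReal\<close> binds \<open>r\<close>, so whatever stays free comes from the keys
  and values of \<open>g\<close>.\<close>

lemma fm_vars_ratio_fm:
  assumes "g \<in> maps_over K V" "finite K" "finite V" "g \<in> G"
  shows "fm_vars (ratio_fm Th r g) \<subseteq> key_vars G \<union> value_vars G"
proof -
  have "tm_vars u\<^sub>1 \<subseteq> key_vars G \<and> tm_vars u\<^sub>2 \<subseteq> value_vars G"
    if "g u\<^sub>1 = Some U\<^sub>2" "u\<^sub>2 \<in> U\<^sub>2" for u\<^sub>1 U\<^sub>2 u\<^sub>2
    using that assms(4) unfolding key_vars_def value_vars_def ran_def dom_def by blast
  then show ?thesis
    by (fastforce simp: ratio_fm_def fm_vars_And_set[OF finite_equations[OF assms(1-3)]])
qed

text \<open>A decision procedure promises an answer only on sentences of the theory. The blocks over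
  \<open>Y\<close> and \<open>Z\<close> together bind every free variable, provided that both are
  finite.\<close>

lemma sentence_check_fm:
  assumes "is_fo_theory Th" "fm_of_theory Th \<phi>\<^sub>A" "fm_of_theory Th \<phi>\<^sub>B"
    and "G \<subseteq> maps_over K V" "finite K" "finite V"
    and "\<And>u. u \<in> K \<union> V \<Longrightarrow> tm_of_theory Th u"
  shows "sentence_of_theory Th (check_fm Th \<phi>\<^sub>A \<phi>\<^sub>B G)"
proof -
  define Y where "Y = key_vars G \<union> fm_vars \<phi>\<^sub>A"
  define Z where "Z = (value_vars G \<union> fm_vars \<phi>\<^sub>B) - Y"
  define r where "r = (SOME r. r \<notin> Y \<union> Z)"
  have check: "check_fm Th \<phi>\<^sub>A \<phi>\<^sub>B G =
      All_set Y (Imp \<phi>\<^sub>A (Ex_set Z (And \<phi>\<^sub>B (Or_set (ratio_fm Th r ` G)))))"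
    unfolding check_fm_def Let_def Y_def Z_def r_def ..
  have G: "finite (ratio_fm Th r ` G)"
    using finite_subset[OF assms(4) finite_maps_over[OF assms(5,6)]] by simp
  have "dom g \<subseteq> K" "\<Union> (ran g) \<subseteq> V" if "g \<in> G" for g
    using that assms(4) unfolding maps_over_def by blast+
  \<comment> \<open>Bounding by unions over \<open>K\<close> and \<open>V\<close> gives finiteness,
    since each term has finitely many variables.\<close>
  then have "key_vars G \<subseteq> (\<Union>u \<in> K. tm_vars u)" "value_vars G \<subseteq> (\<Union>u \<in> V. tm_vars u)"
    unfolding key_vars_def value_vars_def by fast+
  then have "finite (key_vars G)" "finite (value_vars G)"
    using assms(5,6) finite_tm_vars by (meson finite_UN finite_subset)+
  then have fin: "finite Y" "finite Z"
    by (simp_all add: Y_def Z_def finite_fm_vars)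
  have "fm_vars (ratio_fm Th r g) \<subseteq> Y \<union> Z" if "g \<in> G" for g
    using fm_vars_ratio_fm[OF _ assms(5,6) that] that assms(4) by (auto simp: Y_def Z_def)
  then have "fm_vars (check_fm Th \<phi>\<^sub>A \<phi>\<^sub>B G) = {}"
    unfolding check fm_vars_All_set[OF fin(1)] fm_vars.simps fm_vars_Ex_set[OF fin(2)]
      fm_vars_Or_set[OF G]
    by (auto simp: Y_def Z_def)
  moreover have "fm_of_theory Th (check_fm Th \<phi>\<^sub>A \<phi>\<^sub>B G)"
    using assms(2,3,4) fm_of_theory_ratio_fm[OF assms(1) _ assms(5-7)]
    unfolding check by (auto simp: fm_of_theory_Or_set[OF G])
  ultimately show ?thesis
    by (simp add: sentence_of_theory_def)
qed


section \<open>Transitions\<close>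

text \<open>Not the image under \<open>leaf_symbol\<close>: that selector is unspecified on internal
  transitions, so the image could contain a stray term.\<close>

definition leaf_terms :: "('q, 'x, 'f, 'p) lsta \<Rightarrow> ('x, 'f) tm set" where
  "leaf_terms \<C> = {u. \<exists>q C. Leaf q u C \<in> transitions \<C>}"

lemma finite_leaf_terms:
  assumes "is_lsta \<C>"
  shows "finite (leaf_terms \<C>)"
proof -
  have "leaf_terms \<C> \<subseteq> leaf_symbol ` transitions \<C>"
    unfolding leaf_terms_def by force
  then show ?thesis
    using assms by (meson finite_imageI finite_subset is_lsta_def)
qed

lemma tm_of_theory_leaf_terms:
  "expressed_in \<C> Th \<Longrightarrow> u \<in> leaf_terms \<C> \<Longrightarrow> tm_of_theory Th u"
  unfolding expressed_in_def leaf_terms_def by blast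

lemma feas_subset_Pow: "feas \<C> D \<subseteq> Pow (transitions \<C>)"
  by (auto simp: feas_def)

text \<open>A feasible set is the image of a choice function \<open>d\<close> with
  \<open>top_state (d q) = q\<close>, so \<open>d q\<close> is its only member with top
  \<open>q\<close> and the description \<open>THE\<close> is meaningful.\<close>

lemma feas_the_transition:
  assumes "\<Gamma> \<in> feas \<C> D" "q \<in> D"
  shows "(THE \<delta>. \<delta> \<in> \<Gamma> \<and> top_state \<delta> = q) \<in> transitions \<C>"
proof -
  obtain d where d: "\<Gamma> = d ` D" "\<forall>q \<in> D. d q \<in> transitions \<C> \<and> top_state (d q) = q"
    using assms(1) by (auto simp: feas_def)
  then have "(THE \<delta>. \<delta> \<in> \<Gamma> \<and> top_state \<delta> = q) = d q"
    using assms(2) by (intro the_equality) auto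
  then show ?thesis
    using d assms(2) by simp
qed

text \<open>Two leaves contribute their terms to \<open>g\<close>, two internal transitions their
  child states to \<open>f\<close>; nothing else enters the maps.\<close>

lemma match_transitions_in_maps_over:
  assumes "match_transitions \<delta>\<^sub>A \<delta>\<^sub>B (f, g) = Some (f', g')"
    and "is_lsta \<A>" "\<delta>\<^sub>A \<in> transitions \<A>" "is_lsta \<B>" "\<delta>\<^sub>B \<in> transitions \<B>"
    and "f \<in> maps_over (states \<A>) (states \<B>)" "g \<in> maps_over (leaf_terms \<A>) (leaf_terms \<B>)"
  shows "f' \<in> maps_over (states \<A>) (states \<B>) \<and> g' \<in> maps_over (leaf_terms \<A>) (leaf_terms \<B>)"
proof -
  have "bot_states \<delta>\<^sub>A \<subseteq> states \<A>" "bot_states \<delta>\<^sub>B \<subseteq> states \<B>"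
    using assms(2-5) by (auto simp: is_lsta_def)
  then show ?thesis
    using assms(1,3,5-7)
    by (cases \<delta>\<^sub>A; cases \<delta>\<^sub>B)
       (auto simp: leaf_terms_def split: if_splits intro!: add_to_in_maps_over)
qed


section \<open>The loops\<close>

locale entailment =
  fixes Th :: "('f, 'p) fo_theory"
    and M :: "(('x::infinite, 'f, 'p) fm, 'c) machine"
    and \<A> :: "('a, 'x, 'f, 'p) lsta"
    and \<B> :: "('b, 'x, 'f, 'p) lsta"
  assumes theory_Th: "is_fo_theory Th"
    and decision: "decision_procedure M Th"
    and lsta_A: "is_lsta \<A>" and expressed_A: "expressed_in \<A> Th"
    and lsta_B: "is_lsta \<B>" and expressed_B: "expressed_in \<B> Th"
begin

section \<open>The finite universe of map pairs and items\<close>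

definition map_pairs :: "(('a, 'b) state_map \<times> ('x, 'f) term_map) set" where
  "map_pairs = maps_over (states \<A>) (states \<B>) \<times> maps_over (leaf_terms \<A>) (leaf_terms \<B>)"

definition items :: "('a, 'b, 'x, 'f) item set" where
  "items = Pow (states \<A>) \<times> Pow map_pairs"

lemma finite_map_pairs: "finite map_pairs"
  using lsta_A lsta_B
  by (simp add: map_pairs_def is_lsta_def finite_maps_over finite_leaf_terms)

lemma finite_items: "finite items"
  using lsta_A by (simp add: items_def finite_map_pairs is_lsta_def)

lemma finite_feas_A: "finite (feas \<A> D)"
  using finite_subset[OF feas_subset_Pow] lsta_A by (auto simp: is_lsta_def)

lemma finite_feas_B: "finite (feas \<B> D)"
  using finite_subset[OF feas_subset_Pow] lsta_B by (auto simp: is_lsta_def)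

section \<open>Termination of the nested loops, from the innermost outwards\<close>

abbreviation terminating :: "('a, 'b, 'x, 'f, 'c) conf \<Rightarrow> bool" where
  "terminating \<equiv> halts (entail_step Th M \<A> \<B>) (range Return)"

lemma terminating_Return: "terminating (Return b)"
  by (rule haltsI) (auto elim: entail_step.cases)

text \<open>Induction on the derivation of \<open>answers\<close>, that is, on the finite run of the
  machine. A negative answer returns at once; a positive one resumes the main loop.\<close>

lemma terminating_Check:
  assumes "answers M c b" "terminating (While P W)"
  shows "terminating (Check P W c)"
  using assms
proof (induction rule: answers.induct)
  case (1 c b)
  show ?case
  proof (rule haltsI)
    show "Check P W c \<in> range Return \<or> (\<exists>s'. entail_step Th M \<A> \<B> (Check P W c) s')"
      using 1(1) by (cases b) (auto intro: check_valid check_invalid)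
  next
    fix s' assume "entail_step Th M \<A> \<B> (Check P W c) s'"
    then show "terminating s'"
      using 1 by cases (auto intro: terminating_Return)
  qed
next
  case (2 c c' b)
  show ?case
  proof (rule haltsI)
    show "Check P W c \<in> range Return \<or> (\<exists>s'. entail_step Th M \<A> \<B> (Check P W c) s')"
      using 2(1) by (auto intro: check_tick)
  next
    fix s' assume "entail_step Th M \<A> \<B> (Check P W c) s'"
    then show "terminating s'"
      using 2 by cases auto
  qed
qed

text \<open>As in the lemmas on the other loops, the code after the loop enters as a hypothesis,
  here \<open>loop\<close>, for all results within the universe. The induction is on the set
  \<open>E\<close> of pairs still to be visited.\<close>

lemma terminating_Fam_Body:
  assumes loop: "\<And>R'. R' \<subseteq> map_pairs \<Longrightarrow> terminating (Call P W F S \<Gamma>\<^sub>A T F' f g (Fam_Loop L R'))"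
    and "\<Gamma>\<^sub>A \<subseteq> transitions \<A>" and \<Gamma>\<^sub>B: "\<Gamma>\<^sub>B \<in> feas \<B> (\<Union> (ran f))" and R: "R \<subseteq> map_pairs"
    and "finite E" and "E \<subseteq> {(\<delta>\<^sub>A, q). \<delta>\<^sub>A \<in> \<Gamma>\<^sub>A \<and> q \<in> entry f (top_state \<delta>\<^sub>A)}"
    and "m \<in> map_pairs"
  shows "terminating (Call P W F S \<Gamma>\<^sub>A T F' f g (Fam_Body L R \<Gamma>\<^sub>B E m))"
  using assms(5-7)
proof (induction E arbitrary: m rule: finite_psubset_induct)
  case (psubset E)
  let ?s = "Call P W F S \<Gamma>\<^sub>A T F' f g (Fam_Body L R \<Gamma>\<^sub>B E m)"
  show ?case
  proof (rule haltsI)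
    have "\<exists>m'. fam_step \<Gamma>\<^sub>A f (Fam_Body L R \<Gamma>\<^sub>B E m) m'"
    proof (cases "E = {}")
      case True
      then show ?thesis
        by (auto intro: fam_add)
    next
      case False
      then obtain \<delta>\<^sub>A q where "(\<delta>\<^sub>A, q) \<in> E"
        by auto
      then show ?thesis
        by (cases "match_transitions \<delta>\<^sub>A (THE \<delta>. \<delta> \<in> \<Gamma>\<^sub>B \<and> top_state \<delta> = q) m")
           (blast intro: fam_match fam_fail)+
    qed
    then show "?s \<in> range Return \<or> (\<exists>s'. entail_step Th M \<A> \<B> ?s s')"
      by (blast intro: call_step)
  next
    fix s' assume "entail_step Th M \<A> \<B> ?s s'"
    \<comment> \<open>A call can return only from \<open>Fam_Loop {}\<close>, so inside the body the
      step must be one of FindAllMappings.\<close>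
    then obtain c' where s': "s' = Call P W F S \<Gamma>\<^sub>A T F' f g c'"
      and "fam_step \<Gamma>\<^sub>A f (Fam_Body L R \<Gamma>\<^sub>B E m) c'"
      by cases auto
    from this(2) have "terminating (Call P W F S \<Gamma>\<^sub>A T F' f g c')"
    proof cases
      case (fam_match \<delta>\<^sub>A q \<delta>\<^sub>B m')
      have mem: "\<delta>\<^sub>A \<in> \<Gamma>\<^sub>A" "q \<in> entry f (top_state \<delta>\<^sub>A)"
        using fam_match(2) psubset.prems(1) by auto
      \<comment> \<open>This puts \<open>q\<close> among the states for which
        \<open>\<Gamma>\<^sub>B\<close> was chosen, so that \<open>\<delta>\<^sub>B\<close> is a
        genuine transition of \<open>\<B>\<close>.\<close>
      then have "q \<in> \<Union> (ran f)"
        by (auto simp: entry_def ran_def split: option.splits)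
      then have "\<delta>\<^sub>B \<in> transitions \<B>"
        using feas_the_transition[OF \<Gamma>\<^sub>B] fam_match(3) by simp
      then have "m' \<in> map_pairs"
        using fam_match(4) psubset.prems(2) mem(1) assms(2)
          match_transitions_in_maps_over[OF _ lsta_A _ lsta_B, of \<delta>\<^sub>A \<delta>\<^sub>B "fst m" "snd m" "fst m'" "snd m'"]
        by (cases m; cases m') (auto simp: map_pairs_def)
      then show ?thesis
        using fam_match(1,2) psubset.prems(1) by (auto intro!: psubset.IH)
    next
      case fam_fail
      then show ?thesis
        using loop R by simp
    next
      case fam_add
      then show ?thesis
        using loop R psubset.prems(2) by simp
    qed
    then show "terminating s'"
      by (simp add: s')
  qed
qed

text \<open>Induction on the set \<open>L\<close> of feasible sets still to be tried: success and
  failure of the body both lead back to the loop with one set fewer.\<close>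

lemma terminating_Fam_Loop:
  assumes return: "\<And>F''. F'' \<subseteq> map_pairs \<Longrightarrow> terminating (For_Map P W F S \<Gamma>\<^sub>A T F'')"
    and \<Gamma>\<^sub>A: "\<Gamma>\<^sub>A \<subseteq> transitions \<A>" and F': "F' \<subseteq> map_pairs" and fg: "(f, g) \<in> map_pairs"
    and "finite L" and "L \<subseteq> feas \<B> (\<Union> (ran f))" and "R \<subseteq> map_pairs"
  shows "terminating (Call P W F S \<Gamma>\<^sub>A T F' f g (Fam_Loop L R))"
  using assms(5-7)
proof (induction L arbitrary: R rule: finite_psubset_induct)
  case (psubset L)
  let ?s = "Call P W F S \<Gamma>\<^sub>A T F' f g (Fam_Loop L R)"
  let ?E = "{(\<delta>\<^sub>A, q). \<delta>\<^sub>A \<in> \<Gamma>\<^sub>A \<and> q \<in> entry f (top_state \<delta>\<^sub>A)}"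
  have "entry f q \<subseteq> states \<B>" for q
    using fg entry_subset[of f "states \<A>"] by (auto simp: map_pairs_def)
  then have "?E \<subseteq> transitions \<A> \<times> states \<B>"
    using \<Gamma>\<^sub>A by auto
  then have E: "finite ?E"
    using lsta_A lsta_B by (auto simp: is_lsta_def intro: finite_subset)
  show ?case
  proof (rule haltsI)
    show "?s \<in> range Return \<or> (\<exists>s'. entail_step Th M \<A> \<B> ?s s')"
    proof (cases "L = {}")
      case True
      then show ?thesis
        by (blast intro: call_return)
    next
      case False
      then show ?thesis
        by (blast intro: call_step fam_pick)
    qed
  next
    fix s' assume "entail_step Th M \<A> \<B> ?s s'"
    then show "terminating s'"
    proof cases
      case (call_step c')
      from call_step(2) show ?thesis
      proof cases
        case (fam_pick \<Gamma>\<^sub>B)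
        have "terminating (Call P W F S \<Gamma>\<^sub>A T F' f g (Fam_Loop (L - {\<Gamma>\<^sub>B}) R'))"
          if "R' \<subseteq> map_pairs" for R'
          using that fam_pick(2) psubset.prems(1) by (intro psubset.IH) auto
        moreover have "\<Gamma>\<^sub>B \<in> feas \<B> (\<Union> (ran f))"
          using fam_pick(2) psubset.prems(1) by blast
        ultimately show ?thesis
          unfolding call_step(1) fam_pick(1)
          using \<Gamma>\<^sub>A psubset.prems(2) E
          by (intro terminating_Fam_Body) (simp_all add: map_pairs_def empty_in_maps_over)
      qed
    next
      case call_return
      \<comment> \<open>Merging keeps term maps within the same bounds, so the accumulated result
        stays in the universe.\<close>
      have "{(f', merge g g') | f' g'. (f', g') \<in> R} \<subseteq> map_pairs"
        using fg psubset.prems(2) merge_in_maps_over by (fastforce simp: map_pairs_def)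
      then show ?thesis
        unfolding call_return(2) using F' by (intro return) simp
    qed
  qed
qed

text \<open>The hypothesis \<open>outer\<close> covers every workset disjoint from \<open>P\<close>,
  because the end of this loop may insert a new item.\<close>

lemma terminating_For_Map:
  assumes outer: "\<And>W'. W' \<subseteq> items - P \<Longrightarrow> terminating (For_Trans P W' F S)"
    and W: "W \<subseteq> items - P" and \<Gamma>\<^sub>A: "\<Gamma>\<^sub>A \<subseteq> transitions \<A>"
    and "finite T" and "T \<subseteq> map_pairs" and "F' \<subseteq> map_pairs"
  shows "terminating (For_Map P W F S \<Gamma>\<^sub>A T F')"
  using assms(4-6)
proof (induction T arbitrary: F' rule: finite_psubset_induct)
  case (psubset T)
  let ?s = "For_Map P W F S \<Gamma>\<^sub>A T F'"
  show ?case
  proof (rule haltsI)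
    show "?s \<in> range Return \<or> (\<exists>s'. entail_step Th M \<A> \<B> ?s s')"
    proof (cases "T = {}")
      case True
      then show ?thesis
        by (blast intro: map_end)
    next
      case False
      then show ?thesis
        by (metis ex_in_conv map_call surj_pair)
    qed
  next
    fix s' assume "entail_step Th M \<A> \<B> ?s s'"
    then show "terminating s'"
    proof cases
      case (map_call f g)
      have "terminating (For_Map P W F S \<Gamma>\<^sub>A (T - {(f, g)}) F'')" if "F'' \<subseteq> map_pairs" for F''
        using that map_call(2) psubset.prems(1) by (intro psubset.IH) auto
      then show ?thesis
        unfolding map_call(1) fam_init_def
        using map_call(2) psubset.prems \<Gamma>\<^sub>A finite_feas_B
        by (intro terminating_Fam_Loop) auto
    next
      case (map_end W')
      have "\<Union> (bot_states ` \<Gamma>\<^sub>A) \<subseteq> states \<A>"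
        using \<Gamma>\<^sub>A lsta_A unfolding is_lsta_def by blast
      then have "(\<Union> (bot_states ` \<Gamma>\<^sub>A), F') \<in> items"
        using psubset.prems(2) by (simp add: items_def)
      \<comment> \<open>The membership test before insertion keeps processed items from returning to
        the workset.\<close>
      then have "W' \<subseteq> items - P"
        using W map_end by auto
      then show ?thesis
        using outer map_end(2) by simp
    qed
  qed
qed

text \<open>The workset is generalised in the induction since each iteration may enlarge it, while
  \<open>P\<close> stays fixed until the main loop resumes.\<close>

lemma terminating_For_Trans:
  assumes outer: "\<And>W'. W' \<subseteq> items - P \<Longrightarrow> terminating (While P W')"
    and F: "F \<subseteq> map_pairs"
    and "finite S" and "S \<subseteq> Pow (transitions \<A>)" and "W \<subseteq> items - P"
  shows "terminating (For_Trans P W F S)"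
  using assms(3-5)
proof (induction S arbitrary: W rule: finite_psubset_induct)
  case (psubset S)
  let ?s = "For_Trans P W F S"
  show ?case
  proof (rule haltsI)
    show "?s \<in> range Return \<or> (\<exists>s'. entail_step Th M \<A> \<B> ?s s')"
      by (cases "S = {}") (blast intro: trans_end trans_pick)+
  next
    fix s' assume "entail_step Th M \<A> \<B> ?s s'"
    then show "terminating s'"
    proof cases
      case (trans_pick \<Gamma>\<^sub>A)
      have "terminating (For_Trans P W' F (S - {\<Gamma>\<^sub>A}))" if "W' \<subseteq> items - P" for W'
        using that trans_pick(2) psubset.prems(1) by (intro psubset.IH) auto
      then show ?thesis
        unfolding trans_pick(1)
        using trans_pick(2) psubset.prems F finite_subset[OF F finite_map_pairs]
        by (intro terminating_For_Map) auto
    next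
      case trans_end
      then show ?thesis
        using outer psubset.prems(2) by simp
    qed
  qed
qed

lemma answers_check_fm:
  assumes "F \<subseteq> map_pairs"
  shows "\<exists>b. answers M (start M (check_fm Th (constraint \<A>) (constraint \<B>) {g. (Map.empty, g) \<in> F})) b"
proof -
  have "sentence_of_theory Th (check_fm Th (constraint \<A>) (constraint \<B>) {g. (Map.empty, g) \<in> F})"
  proof (rule sentence_check_fm)
    show "{g. (Map.empty, g) \<in> F} \<subseteq> maps_over (leaf_terms \<A>) (leaf_terms \<B>)"
      using assms by (auto simp: map_pairs_def)
    show "finite (leaf_terms \<A>)" "finite (leaf_terms \<B>)"
      using lsta_A lsta_B by (simp_all add: finite_leaf_terms)
    show "fm_of_theory Th (constraint \<A>)" "fm_of_theory Th (constraint \<B>)"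
      using expressed_A expressed_B by (simp_all add: expressed_in_def)
    show "tm_of_theory Th u" if "u \<in> leaf_terms \<A> \<union> leaf_terms \<B>" for u
      using that expressed_A[THEN tm_of_theory_leaf_terms] expressed_B[THEN tm_of_theory_leaf_terms]
      by blast
  qed (rule theory_Th)
  then show ?thesis
    using decision unfolding decision_procedure_def by blast
qed

text \<open>The workset can grow, so the measure is the set \<open>items - P\<close> of unprocessed
  items. The invariant \<open>W \<subseteq> items - P\<close> makes it shrink strictly whenever an
  item is taken from \<open>W\<close>.\<close>

lemma terminating_While:
  assumes "finite (items - P)" and "W \<subseteq> items - P"
  shows "terminating (While P W)"
  using assms
proof (induction "items - P" arbitrary: P W rule: finite_psubset_induct)
  case psubset
  let ?s = "While P W"
  \<comment> \<open>The new workset \<open>W'\<close> is arbitrary, as the inner loops may have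
    added items to it.\<close>
  have IH: "terminating (While (insert i P) W')" if "i \<in> W" "W' \<subseteq> items - insert i P" for i W'
    using that psubset.prems by (intro psubset.hyps) auto
  show ?case
  proof (rule haltsI)
    show "?s \<in> range Return \<or> (\<exists>s'. entail_step Th M \<A> \<B> ?s s')"
    proof (cases "W = {}")
      case True
      then show ?thesis
        by (blast intro: while_end)
    next
      case False
      then show ?thesis
        by (metis ex_in_conv surj_pair while_check while_expand)
    qed
  next
    fix s' assume "entail_step Th M \<A> \<B> ?s s'"
    then show "terminating s'"
    proof cases
      case while_end
      then show ?thesis
        by (simp add: terminating_Return)
    next
      case (while_check F)
      then have "F \<subseteq> map_pairs"
        using psubset.prems by (auto simp: items_def)
      moreover have "terminating (While (insert ({}, F) P) (W - {({}, F)}))"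
        using while_check(2) psubset.prems by (intro IH) auto
      ultimately show ?thesis
        unfolding while_check(1) by (metis answers_check_fm terminating_Check)
    next
      case (while_expand D F)
      then have "F \<subseteq> map_pairs"
        using psubset.prems by (auto simp: items_def)
      then show ?thesis
        unfolding while_expand(1)
        using while_expand(2) psubset.prems feas_subset_Pow[of \<A> D]
        by (intro terminating_For_Trans IH finite_feas_A) auto
    qed
  qed
qed

text \<open>Nothing is processed yet, so the invariant only requires that the items built from root
  states lie in the universe.\<close>

lemma terminating_init: "terminating (entail_init \<A> \<B>)"
  unfolding entail_init_def
proof (rule terminating_While)
  have "root_states \<A> \<subseteq> states \<A>" "root_states \<B> \<subseteq> states \<B>"
    using lsta_A lsta_B by (auto simp: is_lsta_def)
  then show "{({q}, {([q \<mapsto> {r}], Map.empty) | r. r \<in> root_states \<B>}) | q. q \<in> root_states \<A>}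
      \<subseteq> items - {}"
    by (auto simp: items_def map_pairs_def maps_over_def split: if_splits)
qed (simp add: finite_items)

end

theorem theorem2:
  fixes Th :: "('f, 'p) fo_theory"
    and M :: "(('x::infinite, 'f, 'p) fm, 'c) machine"
    and \<A> :: "('a, 'x, 'f, 'p) lsta"
    and \<B> :: "('b, 'x, 'f, 'p) lsta"
  assumes "is_fo_theory Th"
    and "decision_procedure M Th"
    and "is_lsta \<A>" and "expressed_in \<A> Th"
    and "is_lsta \<B>" and "expressed_in \<B> Th"
  shows "always_terminates (entail_step Th M \<A> \<B>) (entail_init \<A> \<B>) (range Return)"
proof -
  interpret entailment Th M \<A> \<B>
    using assms by unfold_locales
  show ?thesis
    using terminating_init by (rule halts_always_terminates)
qed

end
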